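(* Let $X$ be a locally compact Hausdorff topological space with Borel $\sigma$-algebra $\mathcal{B}$. If $\mathcal{B}$ admits at most countably many elementary events, then $\mathcal{M}_{v1}(X)$ is separable and metrizable, and $\mathcal{M}_{v2}(X)$ is separable and metrizable.
   Context: For a topological space $X$ with Borel $\sigma$-algebra $\mathcal{B}$, $\mathcal{M}(X)$ denotes the set of all probability measures on $(X,\mathcal{B})$. A set $A\in\mathcal{B}$ is an elementary event if it does not contain any non-empty proper subset $B\in\mathcal{B}$. A function $f:X\to\mathbb{R}$ vanishes at infinity if $f^{-1}((-\infty,-\epsilon]\cup[\epsilon,\infty))$ is compact for every $\epsilon>0$; its support is the closure of $\{x: f(x)\neq 0\}$. $C_{sc}(X)$ is the set of continuous functions $X\to\mathbb{R}$ with compact support, and $C_0(X)$ is the set of continuous functions $X\to\mathbb{R}$ vanishing at infinity. For $\nu\in\mathcal{M}(X)$, a function $f$ and $\epsilon>0$ put $W(\nu,f,\epsilon)=\{\varrho\in\mathcal{M}(X): |\int_X f\,d\varrho-\int_X f\,d\nu|<\epsilon\}$. $\mathcal{M}_{v1}(X)$ is $\mathcal{M}(X)$ with the Type-I vague topology, generated (as a subbasis) by all $W(\nu,f,\epsilon)$ with $\nu\in\mathcal{M}(X)$, $f\in C_{sc}(X)$, $\epsilon>0$. $\mathcal{M}_{v2}(X)$ is $\mathcal{M}(X)$ with the Type-II vague topology, generated (as a subbasis) by all $W(\nu,f,\epsilon)$ with $\nu\in\mathcal{M}(X)$, $f\in C_0(X)$, $\epsilon>0$. *)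

theory Defs
  imports "HOL-Analysis.Analysis" "HOL-Probability.Probability_Measure"
begin

definition borel_of :: "'a topology \<Rightarrow> 'a measure" where
  "borel_of X = sigma (topspace X) {U. openin X U}"

definition prob_measures :: "'a topology \<Rightarrow> 'a measure set" where
  "prob_measures X = {\<mu>. sets \<mu> = sets (borel_of X) \<and> prob_space \<mu>}"

definition elementary_event :: "'a set set \<Rightarrow> 'a set \<Rightarrow> bool" where
  "elementary_event \<B> A \<longleftrightarrow> A \<in> \<B> \<and> \<not> (\<exists>B\<in>\<B>. B \<noteq> {} \<and> B \<subset> A)"

text \<open>
  Functions on \<open>X\<close> are represented by total functions on the underlying type;
  all notions below depend only on the values on \<open>topspace X\<close>.
\<close>

definition vanishes_at_infinity :: "'a topology \<Rightarrow> ('a \<Rightarrow> real) \<Rightarrow> bool" where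
  "vanishes_at_infinity X f \<longleftrightarrow>
     (\<forall>\<epsilon>>0. compactin X {x \<in> topspace X. f x \<in> {..-\<epsilon>} \<union> {\<epsilon>..}})"

definition support_in :: "'a topology \<Rightarrow> ('a \<Rightarrow> real) \<Rightarrow> 'a set" where
  "support_in X f = X closure_of {x \<in> topspace X. f x \<noteq> 0}"

definition C_sc :: "'a topology \<Rightarrow> ('a \<Rightarrow> real) set" where
  "C_sc X = {f. continuous_map X euclideanreal f \<and> compactin X (support_in X f)}"

definition C_0 :: "'a topology \<Rightarrow> ('a \<Rightarrow> real) set" where
  "C_0 X = {f. continuous_map X euclideanreal f \<and> vanishes_at_infinity X f}"

definition W :: "'a topology \<Rightarrow> 'a measure \<Rightarrow> ('a \<Rightarrow> real) \<Rightarrow> real \<Rightarrow> 'a measure set" where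
  "W X \<nu> f \<epsilon> = {\<rho> \<in> prob_measures X. \<bar>(\<integral>x. f x \<partial>\<rho>) - (\<integral>x. f x \<partial>\<nu>)\<bar> < \<epsilon>}"

definition vague_topology_I :: "'a topology \<Rightarrow> 'a measure topology" where
  "vague_topology_I X = topology_generated_by
     {W X \<nu> f \<epsilon> | \<nu> f \<epsilon>. \<nu> \<in> prob_measures X \<and> f \<in> C_sc X \<and> \<epsilon> > 0}"

definition vague_topology_II :: "'a topology \<Rightarrow> 'a measure topology" where
  "vague_topology_II X = topology_generated_by
     {W X \<nu> f \<epsilon> | \<nu> f \<epsilon>. \<nu> \<in> prob_measures X \<and> f \<in> C_0 X \<and> \<epsilon> > 0}"

text \<open>
  The carrier of \<open>topology_generated_by\<close> is the union of the subbasis;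
  here it is all of \<open>prob_measures X\<close>, as the zero function is admissible.
\<close>

lemma topspace_vague_topology_I: "topspace (vague_topology_I X) = prob_measures X"
proof -
  have "(\<lambda>x. 0) \<in> C_sc X"
    by (simp add: C_sc_def support_in_def)
  moreover have "\<nu> \<in> W X \<nu> (\<lambda>x. 0) 1" if "\<nu> \<in> prob_measures X" for \<nu>
    using that by (simp add: W_def)
  ultimately have "prob_measures X \<subseteq> topspace (vague_topology_I X)"
    unfolding vague_topology_I_def topology_generated_by_topspace
    using zero_less_one by blast
  moreover have "topspace (vague_topology_I X) \<subseteq> prob_measures X"
    unfolding vague_topology_I_def topology_generated_by_topspace by (auto simp: W_def)
  ultimately show ?thesis
    by blast
qed

lemma topspace_vague_topology_II: "topspace (vague_topology_II X) = prob_measures X"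
proof -
  have "(\<lambda>x. 0) \<in> C_0 X"
    by (auto simp: C_0_def vanishes_at_infinity_def)
  moreover have "\<nu> \<in> W X \<nu> (\<lambda>x. 0) 1" if "\<nu> \<in> prob_measures X" for \<nu>
    using that by (simp add: W_def)
  ultimately have "prob_measures X \<subseteq> topspace (vague_topology_II X)"
    unfolding vague_topology_II_def topology_generated_by_topspace
    using zero_less_one by blast
  moreover have "topspace (vague_topology_II X) \<subseteq> prob_measures X"
    unfolding vague_topology_II_def topology_generated_by_topspace by (auto simp: W_def)
  ultimately show ?thesis
    by blast
qed

end

theory Submission
  imports Defs
begin

text \<open>
  Points of a Hausdorff space are elementary events, so \<open>X\<close> is countable. A real function on a
  countable set misses arbitrarily small levels, and cutting at missed levels yields compact open
  sets: they form a countable family \<open>\<K>\<close> separating points, and every \<open>f \<in> C_0 X\<close> is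
  a uniform limit of finite linear combinations of their indicators. Hence both vague topologies
  are the initial topology of the countably many maps \<open>\<mu> \<mapsto> \<mu> K\<close> with \<open>K \<in> \<K>\<close>, which embed
  the probability measures into the separable metric space of real sequences.
\<close>

definition compact_opens :: "'a topology \<Rightarrow> 'a set set" where
  "compact_opens X = {K. compactin X K \<and> openin X K}"

text \<open>The class \<open>F\<close> of test functions is a parameter so that one argument serves
  both vague topologies, with \<open>C_sc X\<close> and \<open>C_0 X\<close> as instances.\<close>

definition weak_topology :: "'a topology \<Rightarrow> ('a \<Rightarrow> real) set \<Rightarrow> 'a measure topology" where
  "weak_topology X F = topology_generated_by
     {W X \<nu> f \<epsilon> | \<nu> f \<epsilon>. \<nu> \<in> prob_measures X \<and> f \<in> F \<and> \<epsilon> > 0}"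

section \<open>Borel sets and countability of the space\<close>

lemma space_borel_of: "space (borel_of X) = topspace X"
  by (simp add: borel_of_def space_measure_of_conv)

lemma sets_borel_of: "sets (borel_of X) = sigma_sets (topspace X) {U. openin X U}"
  unfolding borel_of_def by (rule sets_measure_of) (auto dest: openin_subset)

lemma openin_imp_borel_of: "openin X U \<Longrightarrow> U \<in> sets (borel_of X)"
  by (simp add: sets_borel_of)

lemma closedin_imp_borel_of:
  assumes "closedin X C"
  shows "C \<in> sets (borel_of X)"
proof -
  have "space (borel_of X) - (topspace X - C) \<in> sets (borel_of X)"
    using assms by (intro sets.compl_sets openin_imp_borel_of) auto
  then show ?thesis
    using closedin_subset[OF assms] by (simp add: space_borel_of double_diff)
qed

text \<open>Singletons are closed, hence Borel, and have no non-empty proper subset, so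
  \<open>x\<close> maps to \<open>{x}\<close> injectively into the elementary events.\<close>

lemma countable_topspace_if_countable_elementary_events:
  assumes "Hausdorff_space X" "countable {A. elementary_event (sets (borel_of X)) A}"
  shows "countable (topspace X)"
proof -
  have "(\<lambda>x. {x}) ` topspace X \<subseteq> {A. elementary_event (sets (borel_of X)) A}"
    using assms(1) by (auto simp: elementary_event_def closedin_Hausdorff_singleton closedin_imp_borel_of)
  then have "countable ((\<lambda>x. {x}) ` topspace X)"
    using assms(2) countable_subset by blast
  then show ?thesis
    by (rule countable_image_inj_on) auto
qed

lemma ex_small_notin_countable:
  fixes A :: "real set"
  assumes "countable A" "e > 0"
  obtains a where "0 < a" "a < e" "a \<notin> A"
proof -
  have "\<not> {0<..<e} \<subseteq> A"
    using assms countable_subset uncountable_open_interval by blast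
  then obtain a where "a \<in> {0<..<e}" "a \<notin> A"
    by blast
  then show ?thesis
    using that[of a] by simp
qed

lemma empty_compact_opens: "{} \<in> compact_opens X"
  by (simp add: compact_opens_def)

lemma compact_opens_subset: "K \<in> compact_opens X \<Longrightarrow> K \<subseteq> topspace X"
  by (auto simp: compact_opens_def dest: openin_subset)

text \<open>The set where \<open>\<bar>f x\<bar>\<close> is at least 1 is compact, so its continuous
  image is bounded; elsewhere 1 is a bound.\<close>

lemma C_0_bounded:
  assumes "f \<in> C_0 X"
  obtains B where "\<And>x. x \<in> topspace X \<Longrightarrow> \<bar>f x\<bar> \<le> B"
proof -
  define C where "C = {x \<in> topspace X. f x \<in> {..-1} \<union> {1..}}"
  have "compactin X C" "continuous_map X euclideanreal f"
    using assms unfolding C_def C_0_def vanishes_at_infinity_def by auto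
  then have "bounded (f ` C)"
    using image_compactin compact_imp_bounded by (metis compactin_euclidean_iff)
  then obtain B where B: "\<And>x. x \<in> C \<Longrightarrow> \<bar>f x\<bar> \<le> B"
    unfolding bounded_iff by auto
  have "\<bar>f x\<bar> \<le> max B 1" if "x \<in> topspace X" for x
  proof (cases "x \<in> C")
    case False
    then show ?thesis
      using that unfolding C_def by auto
  qed (use B in force)
  then show ?thesis
    using that[of "max B 1"] by blast
qed

section \<open>Topologies generated by integrals of test functions\<close>

lemma topspace_weak_topology:
  assumes "f \<in> F"
  shows "topspace (weak_topology X F) = prob_measures X"
proof
  have "\<mu> \<in> W X \<mu> f 1" if "\<mu> \<in> prob_measures X" for \<mu>
    using that by (simp add: W_def)
  then show "prob_measures X \<subseteq> topspace (weak_topology X F)"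
    unfolding weak_topology_def topology_generated_by_topspace using assms zero_less_one by blast
  show "topspace (weak_topology X F) \<subseteq> prob_measures X"
    unfolding weak_topology_def topology_generated_by_topspace by (auto simp: W_def)
qed

lemma continuous_map_weak_topology_integral:
  assumes "f \<in> F"
  shows "continuous_map (weak_topology X F) euclideanreal (\<lambda>\<mu>. \<integral>x. f x \<partial>\<mu>)"
  unfolding continuous_map_def topspace_weak_topology[OF assms]
proof (intro conjI allI impI)
  fix U :: "real set"
  assume "openin euclidean U"
  then have U: "open U"
    by simp
  let ?P = "{\<mu> \<in> prob_measures X. (\<integral>x. f x \<partial>\<mu>) \<in> U}"
  show "openin (weak_topology X F) ?P"
  proof (subst openin_subopen, intro ballI)
    fix \<mu> assume \<mu>: "\<mu> \<in> ?P"
    then obtain e where e: "e > 0" "\<And>y. dist y (\<integral>x. f x \<partial>\<mu>) < e \<Longrightarrow> y \<in> U"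
      using U unfolding open_dist by auto
    \<comment> \<open>The subbasis allows any probability measure as centre, so the neighbourhood
      can be centred at \<open>\<mu>\<close> itself.\<close>
    have "openin (weak_topology X F) (W X \<mu> f e)"
      unfolding weak_topology_def using \<mu> e(1) assms by (intro topology_generated_by_Basis) auto
    moreover have "\<mu> \<in> W X \<mu> f e" "W X \<mu> f e \<subseteq> ?P"
      using \<mu> e by (auto simp: W_def dist_real_def)
    ultimately show "\<exists>T. openin (weak_topology X F) T \<and> \<mu> \<in> T \<and> T \<subseteq> ?P"
      by blast
  qed
qed auto

locale countable_lc_Hausdorff =
  fixes X :: "'a topology"
  assumes lc: "locally_compact_space X"
    and Hausdorff: "Hausdorff_space X"
    and countable_points: "countable (topspace X)"
begin

section \<open>Compact open sets of a countable locally compact Hausdorff space\<close>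

lemma compact_opens_Int: "K \<in> compact_opens X \<Longrightarrow> L \<in> compact_opens X \<Longrightarrow> K \<inter> L \<in> compact_opens X"
  using Hausdorff by (auto simp: compact_opens_def compactin_Int)

lemma ex_compact_open_separating:
  assumes "x \<in> topspace X"
  shows "\<exists>K. K \<in> compact_opens X \<and> x \<in> K \<and> (x \<noteq> y \<longrightarrow> y \<notin> K)"
proof -
  obtain U C where U: "openin X U" "compactin X C" "x \<in> U" "U \<subseteq> C"
    using lc assms unfolding locally_compact_space_def by meson
  define V where "V = (if x = y then U else U - {y})"
  have V: "openin X V" "x \<in> V" "V \<subseteq> C" "x \<noteq> y \<Longrightarrow> y \<notin> V"
    using U Hausdorff by (auto simp: V_def open_in_Hausdorff_delete)
  have "completely_regular_space X"
    using lc Hausdorff locally_compact_regular_imp_completely_regular_space by blast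
  moreover have "closedin X (topspace X - V)" "x \<in> topspace X - (topspace X - V)"
    using V assms by auto
  ultimately obtain f :: "'a \<Rightarrow> real" where
    f: "continuous_map X (top_of_set {0..1}) f" "f x = 0" "f ` (topspace X - V) \<subseteq> {1}"
    unfolding completely_regular_space_def by meson
  have cf: "continuous_map X euclideanreal f"
    using f(1) continuous_map_in_subtopology by blast
  obtain a where a: "0 < a" "a < 1" "a \<notin> f ` topspace X"
    using ex_small_notin_countable[of "f ` topspace X" 1] countable_points by auto
  define K where "K = {z \<in> topspace X. f z \<in> {..<a}}"
  \<comment> \<open>The level \<open>a\<close> is not attained, so strict and non-strict sublevel
    sets agree; the first form is open, the second closed.\<close>
  have K_eq: "K = {z \<in> topspace X. f z \<in> {..a}}"
    using a(3) by (force simp: K_def order.order_iff_strict)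
  have "openin X K"
    unfolding K_def using cf by (rule openin_continuous_map_preimage) auto
  moreover have "closedin X K"
    unfolding K_eq using cf by (rule closedin_continuous_map_preimage) auto
  moreover have "K \<subseteq> V"
    using f(3) a unfolding K_def by force
  ultimately have "K \<in> compact_opens X"
    using closed_compactin[OF U(2)] V(3) unfolding compact_opens_def by auto
  moreover have "x \<in> K"
    using assms f(2) a by (simp add: K_def)
  ultimately show ?thesis
    using V(4) \<open>K \<subseteq> V\<close> by blast
qed

text \<open>One chosen separating set \<open>L x y\<close> for each pair of points makes a countable
  family. Its finite intersections \<open>B\<close> are countably many, and by compactness every
  compact open set is a finite union of members of \<open>B\<close>.\<close>

lemma countable_compact_opens: "countable (compact_opens X)"
proof -
  define L where "L x y = (SOME K. K \<in> compact_opens X \<and> x \<in> K \<and> (x \<noteq> y \<longrightarrow> y \<notin> K))" for x y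
  have L: "L x y \<in> compact_opens X" "x \<in> L x y" "x \<noteq> y \<Longrightarrow> y \<notin> L x y" if "x \<in> topspace X" for x y
    using someI_ex[OF ex_compact_open_separating[OF that, of y]] unfolding L_def by blast+
  define B where "B = {\<Inter>(L x ` Y) | x Y. x \<in> topspace X \<and> finite Y \<and> Y \<subseteq> topspace X \<and> Y \<noteq> {}}"
  have "B \<subseteq> (\<lambda>(x, Y). \<Inter>(L x ` Y)) ` (topspace X \<times> {Y. finite Y \<and> Y \<subseteq> topspace X})"
    unfolding B_def by force
  moreover have "countable (topspace X \<times> {Y. finite Y \<and> Y \<subseteq> topspace X})"
    using countable_points by (intro countable_SIGMA countable_Collect_finite_subset)
  ultimately have "countable B"
    using countable_image countable_subset by blast
  then have "countable {\<F>. finite \<F> \<and> \<F> \<subseteq> B}"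
    by (rule countable_Collect_finite_subset)
  moreover have "compact_opens X \<subseteq> Union ` {\<F>. finite \<F> \<and> \<F> \<subseteq> B}"
  proof
    fix K assume K: "K \<in> compact_opens X"
    have basic: "\<exists>b. b \<in> B \<and> x \<in> b \<and> b \<subseteq> K \<and> openin X b" if x: "x \<in> K" for x
    proof -
      have xX: "x \<in> topspace X"
        using x K compact_opens_subset by auto
      \<comment> \<open>This compact remainder is covered by the complements of the sets
        \<open>L x y\<close> with \<open>y\<close> outside \<open>K\<close>. A finite subcover names
        finitely many \<open>L x y\<close> whose intersection with \<open>L x x\<close> stays inside
        \<open>K\<close>.\<close>
      have "compactin X (L x x - K)"
      proof (rule closed_compactin)
        show "compactin X (L x x)"
          using L(1)[OF xX] by (simp add: compact_opens_def)
        show "closedin X (L x x - K)"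
          using L(1)[OF xX] K Hausdorff
          by (intro closedin_diff compactin_imp_closedin) (auto simp: compact_opens_def)
      qed auto
      moreover have "openin X (topspace X - L x y)" for y
        using L(1)[OF xX] Hausdorff
        by (intro openin_diff openin_topspace compactin_imp_closedin) (auto simp: compact_opens_def)
      moreover have "L x x - K \<subseteq> \<Union>((\<lambda>y. topspace X - L x y) ` (topspace X - K))"
      proof
        fix y assume y: "y \<in> L x x - K"
        then have "y \<in> topspace X" "y \<notin> L x y"
          using compact_opens_subset[OF L(1)[OF xX]] L(3)[OF xX, of y] x by auto
        then show "y \<in> \<Union>((\<lambda>y. topspace X - L x y) ` (topspace X - K))"
          using y by auto
      qed
      ultimately obtain \<F> where \<F>: "finite \<F>" "\<F> \<subseteq> (\<lambda>y. topspace X - L x y) ` (topspace X - K)"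
          "L x x - K \<subseteq> \<Union>\<F>"
        unfolding compactin_def by (auto dest!: spec[of _ "(\<lambda>y. topspace X - L x y) ` (topspace X - K)"])
      then obtain Y where Y: "finite Y" "Y \<subseteq> topspace X - K" "\<F> = (\<lambda>y. topspace X - L x y) ` Y"
        by (meson finite_subset_image)
      \<comment> \<open>Inserting \<open>x\<close> brings in \<open>L x x\<close> and keeps the
        index set non-empty even if \<open>Y\<close> is empty.\<close>
      define b where "b = \<Inter>(L x ` insert x Y)"
      have "b \<in> B"
        unfolding B_def b_def using Y xX by blast
      moreover have "x \<in> b" "b \<subseteq> K"
        using L(2)[OF xX] \<F>(3) Y(3) unfolding b_def by auto
      moreover have "openin X b"
        unfolding b_def using Y(1) L(1)[OF xX]
        by (intro openin_Inter) (auto simp: compact_opens_def)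
      ultimately show ?thesis
        by blast
    qed
    define \<U> where "\<U> = {b \<in> B. b \<subseteq> K \<and> openin X b}"
    have "K \<subseteq> \<Union>\<U>"
      using basic unfolding \<U>_def by blast
    moreover have "\<forall>U\<in>\<U>. openin X U"
      unfolding \<U>_def by auto
    ultimately obtain \<F> where "finite \<F>" "\<F> \<subseteq> \<U>" "K \<subseteq> \<Union>\<F>"
      using K unfolding compact_opens_def compactin_def by blast
    then have "finite \<F>" "\<F> \<subseteq> B" "K = \<Union>\<F>"
      unfolding \<U>_def by auto
    then show "K \<in> Union ` {\<F>. finite \<F> \<and> \<F> \<subseteq> B}"
      by blast
  qed
  ultimately show ?thesis
    by (meson countable_image countable_subset)
qed

section \<open>The discrete Borel algebra and its probability measures\<close>

lemma sets_borel_of_eq_Pow: "sets (borel_of X) = Pow (topspace X)"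
proof
  show "sets (borel_of X) \<subseteq> Pow (topspace X)"
    using sets.space_closed[of "borel_of X"] by (simp add: space_borel_of)
  show "Pow (topspace X) \<subseteq> sets (borel_of X)"
  proof
    fix A assume A: "A \<in> Pow (topspace X)"
    then have "countable A"
      using countable_points countable_subset by auto
    moreover have "{a} \<in> sets (borel_of X)" if "a \<in> A" for a
      using A Hausdorff that by (intro closedin_imp_borel_of closedin_Hausdorff_singleton) auto
    ultimately show "A \<in> sets (borel_of X)"
      by (rule sets.countable[rotated])
  qed
qed

text \<open>By separation, each singleton is the intersection of the countably many compact open
  sets containing it, and every subset is a countable union of singletons.\<close>

lemma sigma_sets_compact_opens: "sigma_sets (topspace X) (compact_opens X) = Pow (topspace X)"
proof -
  interpret S: sigma_algebra "topspace X" "sigma_sets (topspace X) (compact_opens X)"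
    using compact_opens_subset by (intro sigma_algebra_sigma_sets) auto
  have sing: "{x} \<in> sigma_sets (topspace X) (compact_opens X)" if x: "x \<in> topspace X" for x
  proof -
    have "{x} = (\<Inter>K\<in>{K \<in> compact_opens X. x \<in> K}. K)"
    proof (intro equalityI subsetI)
      fix y assume "y \<in> (\<Inter>K\<in>{K \<in> compact_opens X. x \<in> K}. K)"
      then show "y \<in> {x}"
        using ex_compact_open_separating[OF x, of y] by auto
    qed auto
    moreover have "(\<Inter>K\<in>{K \<in> compact_opens X. x \<in> K}. K) \<in> sigma_sets (topspace X) (compact_opens X)"
    proof (rule S.countable_INT')
      show "countable {K \<in> compact_opens X. x \<in> K}"
        using countable_compact_opens by (rule countable_subset[rotated]) auto
      show "{K \<in> compact_opens X. x \<in> K} \<noteq> {}"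
        using ex_compact_open_separating[OF x] by blast
    qed auto
    ultimately show ?thesis
      by simp
  qed
  have "A \<in> sigma_sets (topspace X) (compact_opens X)" if "A \<subseteq> topspace X" for A
  proof -
    have "(\<Union>x\<in>A. {x}) \<in> sigma_sets (topspace X) (compact_opens X)"
      using that sing countable_subset[OF that countable_points] by (intro S.countable_UN') auto
    then show ?thesis
      by simp
  qed
  then show ?thesis
    using S.space_closed by auto
qed

lemma prob_measures_sets:
  assumes "\<mu> \<in> prob_measures X"
  shows "sets \<mu> = Pow (topspace X)" "space \<mu> = topspace X"
proof -
  show "sets \<mu> = Pow (topspace X)"
    using assms by (simp add: prob_measures_def sets_borel_of_eq_Pow)
  show "space \<mu> = topspace X"
    using assms sets_eq_imp_space_eq[of \<mu> "borel_of X"] by (simp add: prob_measures_def space_borel_of)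
qed

text \<open>Uniqueness of measures on an intersection-stable generator. The whole space need not be
  compact, so the version with a countable cover by generators is applied. This gives injectivity of
  the embedding below.\<close>

lemma prob_measures_eqI:
  assumes "\<mu> \<in> prob_measures X" "\<nu> \<in> prob_measures X"
    and eq: "\<And>K. K \<in> compact_opens X \<Longrightarrow> measure \<mu> K = measure \<nu> K"
  shows "\<mu> = \<nu>"
proof (rule measure_eqI_generator_eq_countable)
  interpret \<mu>: prob_space \<mu>
    using assms by (simp add: prob_measures_def)
  interpret \<nu>: prob_space \<nu>
    using assms by (simp add: prob_measures_def)
  show "Int_stable (compact_opens X)"
    using compact_opens_Int by (auto simp: Int_stable_def)
  show "compact_opens X \<subseteq> Pow (topspace X)"
    using compact_opens_subset by auto
  show "emeasure \<mu> K = emeasure \<nu> K" if "K \<in> compact_opens X" for K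
    using eq[OF that] by (simp add: \<mu>.emeasure_eq_measure \<nu>.emeasure_eq_measure)
  show "sets \<mu> = sigma_sets (topspace X) (compact_opens X)" "sets \<nu> = sigma_sets (topspace X) (compact_opens X)"
    using assms prob_measures_sets sigma_sets_compact_opens by auto
  show "\<Union>(compact_opens X) = topspace X"
    using ex_compact_open_separating compact_opens_subset by (meson Sup_least UnionI subsetI subset_antisym)
  show "countable (compact_opens X)"
    by (rule countable_compact_opens)
  show "emeasure \<mu> K \<noteq> \<infinity>" for K
    by (simp add: \<mu>.emeasure_eq_measure)
qed auto

section \<open>Approximation by combinations of indicators of compact open sets\<close>

text \<open>Round \<open>f\<close> to the nearest multiple of a step \<open>a < e\<close> chosen so
  that \<open>f\<close> never hits a midpoint \<open>a * (k + 1/2)\<close>. The bands between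
  consecutive midpoints are then clopen, and those with \<open>k \<noteq> 0\<close> are compact
  because \<open>f\<close> vanishes at infinity.\<close>

lemma C_0_uniform_approx:
  assumes f: "f \<in> C_0 X" and e: "e > 0"
  obtains I :: "int set" and K c where "finite I" "\<And>i. i \<in> I \<Longrightarrow> K i \<in> compact_opens X"
    "\<And>x. x \<in> topspace X \<Longrightarrow> \<bar>f x - (\<Sum>i\<in>I. c i * indicator (K i) x)\<bar> \<le> e"
proof -
  have cf: "continuous_map X euclideanreal f" and vf: "vanishes_at_infinity X f"
    using f by (auto simp: C_0_def)
  \<comment> \<open>\<open>A\<close> contains every positive \<open>a\<close> for which
    \<open>f\<close> would hit some midpoint; it is countable because \<open>X\<close> is.\<close>
  define A where "A = (\<lambda>(x, k::int). f x / (of_int k + 1/2)) ` (topspace X \<times> UNIV)"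
  have "countable A"
    unfolding A_def using countable_points by (intro countable_image countable_SIGMA) auto
  then obtain a where a: "0 < a" "a < e" "a \<notin> A"
    using ex_small_notin_countable e by blast
  have miss: "f x \<noteq> a * (of_int k + 1/2)" if "x \<in> topspace X" for x and k :: int
  proof
    assume "f x = a * (of_int k + 1/2)"
    moreover have "real_of_int k + 1/2 \<noteq> 0"
    proof
      assume "real_of_int k + 1/2 = 0"
      then have "real_of_int (2 * k + 1) = 0"
        by simp
      then have "2 * k + 1 = 0"
        by linarith
      then show False
        by presburger
    qed
    ultimately have "a = f x / (of_int k + 1/2)"
      by simp
    then show False
      using a(3) that unfolding A_def by force
  qed
  define K where "K k = {x \<in> topspace X. f x \<in> {a * (of_int k - 1/2) <..< a * (of_int k + 1/2)}}" for k :: int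
  \<comment> \<open>Both ends of the band are missed midpoints, those with indices
    \<open>k - 1\<close> and \<open>k\<close>.\<close>
  have K_eq: "K k = {x \<in> topspace X. f x \<in> {a * (of_int k - 1/2) .. a * (of_int k + 1/2)}}" for k
    using miss[of _ k] miss[of _ "k - 1"] by (force simp: K_def order.order_iff_strict)
  have K: "K k \<in> compact_opens X" if "k \<noteq> 0" for k
  proof -
    have "openin X (K k)"
      unfolding K_def using cf by (rule openin_continuous_map_preimage) auto
    moreover have "closedin X (K k)"
      unfolding K_eq using cf by (rule closedin_continuous_map_preimage) auto
    moreover have "compactin X {x \<in> topspace X. f x \<in> {..-(a/2)} \<union> {a/2..}}"
      using vf a(1) half_gt_zero unfolding vanishes_at_infinity_def by blast
    \<comment> \<open>A band with \<open>k \<noteq> 0\<close> stays at distance at least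
      \<open>a/2\<close> from 0.\<close>
    moreover have "K k \<subseteq> {x \<in> topspace X. f x \<in> {..-(a/2)} \<union> {a/2..}}"
    proof -
      consider "k \<ge> 1" | "k \<le> -1"
        using \<open>k \<noteq> 0\<close> by linarith
      then show ?thesis
      proof cases
        case 1
        then have "a * (1/2) \<le> a * (of_int k - 1/2)"
          using a(1) by (intro mult_left_mono) auto
        then show ?thesis
          unfolding K_def by auto
      next
        case 2
        then have "a * (of_int k + 1/2) \<le> a * (-1/2)"
          using a(1) by (intro mult_left_mono) auto
        then show ?thesis
          unfolding K_def by auto
      qed
    qed
    ultimately show ?thesis
      using closed_compactin unfolding compact_opens_def by blast
  qed
  obtain B where B: "\<And>x. x \<in> topspace X \<Longrightarrow> \<bar>f x\<bar> \<le> B"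
    using C_0_bounded[OF f] by blast
  define N where "N = \<lceil>B / a\<rceil> + 1"
  \<comment> \<open>The band around 0 need not be compact; it is left out at no cost, since its
    coefficient \<open>a * 0\<close> would be zero.\<close>
  define I where "I = {-N..N} - {0}"
  have "\<bar>f x - (\<Sum>i\<in>I. a * of_int i * indicator (K i) x)\<bar> \<le> e" if x: "x \<in> topspace X" for x
  proof -
    \<comment> \<open>Index of the only band containing \<open>x\<close>: \<open>f x / a\<close>
      rounded to the nearest integer.\<close>
    define k where "k = \<lfloor>f x / a + 1/2\<rfloor>"
    have "of_int k \<le> f x / a + 1/2" "f x / a + 1/2 < of_int k + 1"
      unfolding k_def by linarith+
    then have k: "a * (of_int k - 1/2) \<le> f x" "f x < a * (of_int k + 1/2)"
      using a(1) by (auto simp: field_simps)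
    have xK: "x \<in> K i \<longleftrightarrow> i = k" for i
    proof
      assume "x \<in> K i"
      then have "a * (of_int i - 1/2) < f x" "f x < a * (of_int i + 1/2)"
        unfolding K_def by auto
      then have "a * (of_int i - 1/2) < a * (of_int k + 1/2)" "a * (of_int k - 1/2) < a * (of_int i + 1/2)"
        using k by linarith+
      then have "real_of_int i - 1/2 < of_int k + 1/2" "real_of_int k - 1/2 < of_int i + 1/2"
        using a(1) mult_less_cancel_left_pos by blast+
      then show "i = k"
        by linarith
    next
      assume "i = k"
      then show "x \<in> K i"
        using k x unfolding K_eq by auto
    qed
    have "\<bar>f x / a\<bar> \<le> B / a"
      using B[OF x] a(1) by (simp add: divide_right_mono)
    then have "-(B / a) \<le> f x / a" "f x / a \<le> B / a"
      by linarith+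
    then have k_range: "k \<in> {-N..N}"
      unfolding k_def N_def atLeastAtMost_iff by linarith
    have "(\<Sum>i\<in>I. a * of_int i * indicator (K i) x) = (\<Sum>i\<in>I. if i = k then a * of_int k else 0)"
      by (intro sum.cong) (auto simp: xK indicator_def)
    \<comment> \<open>If \<open>k = 0\<close> then no index in \<open>I\<close> matches and both
      sides are zero.\<close>
    also have "\<dots> = a * of_int k"
      using k_range by (simp add: I_def)
    finally have "(\<Sum>i\<in>I. a * of_int i * indicator (K i) x) = a * of_int k" .
    moreover have "\<bar>f x - a * of_int k\<bar> \<le> a"
      using k a(1) unfolding right_diff_distrib distrib_left by linarith
    ultimately show ?thesis
      using a(2) by linarith
  qed
  then show ?thesis
    using that[of I K "\<lambda>i. a * of_int i"] K by (auto simp: I_def)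
qed

lemma C_0_integrable:
  assumes "f \<in> C_0 X" "\<mu> \<in> prob_measures X"
  shows "integrable \<mu> f"
proof -
  interpret \<mu>: prob_space \<mu>
    using assms by (simp add: prob_measures_def)
  obtain B where "\<And>x. x \<in> topspace X \<Longrightarrow> \<bar>f x\<bar> \<le> B"
    using C_0_bounded[OF assms(1)] by blast
  then show ?thesis
    using prob_measures_sets[OF assms(2)]
    by (intro \<mu>.integrable_const_bound[of _ B]) (auto simp: measurable_def)
qed

text \<open>Integrating the uniform estimate against total mass 1 keeps the error \<open>e\<close>.
  The same \<open>I\<close>, \<open>K\<close> and \<open>c\<close> work for all \<open>\<mu>\<close>
  at once, which the continuity proof below relies on.\<close>

lemma C_0_integral_uniform_approx:
  assumes f: "f \<in> C_0 X" and e: "e > 0"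
  obtains I :: "int set" and K c where "finite I" "\<And>i. i \<in> I \<Longrightarrow> K i \<in> compact_opens X"
    "\<And>\<mu>. \<mu> \<in> prob_measures X \<Longrightarrow> \<bar>(\<integral>x. f x \<partial>\<mu>) - (\<Sum>i\<in>I. c i * measure \<mu> (K i))\<bar> \<le> e"
proof -
  obtain I :: "int set" and K c where I: "finite I" "\<And>i. i \<in> I \<Longrightarrow> K i \<in> compact_opens X"
    "\<And>x. x \<in> topspace X \<Longrightarrow> \<bar>f x - (\<Sum>i\<in>I. c i * indicator (K i) x)\<bar> \<le> e"
    using C_0_uniform_approx[OF assms] by blast
  have "\<bar>(\<integral>x. f x \<partial>\<mu>) - (\<Sum>i\<in>I. c i * measure \<mu> (K i))\<bar> \<le> e" if \<mu>: "\<mu> \<in> prob_measures X" for \<mu>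
  proof -
    interpret \<mu>: prob_space \<mu>
      using \<mu> by (simp add: prob_measures_def)
    let ?g = "\<lambda>x. \<Sum>i\<in>I. c i * indicator (K i) x"
    note fi = C_0_integrable[OF f \<mu>]
    have sets: "K i \<in> sets \<mu>" if "i \<in> I" for i
      using I(2)[OF that] compact_opens_subset prob_measures_sets[OF \<mu>] by auto
    have ii: "integrable \<mu> (\<lambda>x. c i * indicator (K i) x)" if "i \<in> I" for i
      using sets[OF that]
      by (intro integrable_mult_right integrable_real_indicator) (auto simp: \<mu>.emeasure_eq_measure)
    have gi: "integrable \<mu> ?g"
      using ii by (intro Bochner_Integration.integrable_sum)
    have "(\<integral>x. ?g x \<partial>\<mu>) = (\<Sum>i\<in>I. c i * measure \<mu> (K i))"
      using sets ii by (subst Bochner_Integration.integral_sum) auto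
    then have "(\<integral>x. f x \<partial>\<mu>) - (\<Sum>i\<in>I. c i * measure \<mu> (K i)) = (\<integral>x. f x - ?g x \<partial>\<mu>)"
      using fi gi by simp
    also have "\<bar>\<dots>\<bar> \<le> (\<integral>x. \<bar>f x - ?g x\<bar> \<partial>\<mu>)"
      by (rule integral_abs_bound)
    also have "\<dots> \<le> (\<integral>x. e \<partial>\<mu>)"
      using fi gi I(3) prob_measures_sets(2)[OF \<mu>] by (intro integral_mono) auto
    also have "\<dots> = e"
      by (simp add: \<mu>.prob_space)
    finally show ?thesis .
  qed
  then show ?thesis
    using that I(1,2) by blast
qed

section \<open>Embedding into real sequences\<close>

text \<open>The embedding lists the measures of all compact open sets. Indicators in
  \<open>F\<close> make it continuous; \<open>F \<subseteq> C_0 X\<close> makes its inverse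
  continuous, by uniform approximation.\<close>

lemma weak_topology_homeomorphic_subset:
  assumes F: "F \<subseteq> C_0 X" and ind: "\<And>K. K \<in> compact_opens X \<Longrightarrow> indicator K \<in> F"
  shows "\<exists>S :: (nat \<Rightarrow> real) set. weak_topology X F homeomorphic_space top_of_set S"
proof -
  let ?T = "weak_topology X F"
  define E where "E = from_nat_into (compact_opens X)"
  \<comment> \<open>The empty set keeps the family non-empty, so \<open>from_nat_into\<close> lands
    in it for every \<open>n\<close>, even if the family is finite.\<close>
  have E: "E n \<in> compact_opens X" for n
    unfolding E_def using empty_compact_opens by (intro from_nat_into) auto
  have E_surj: "\<exists>n. E n = K" if "K \<in> compact_opens X" for K
    unfolding E_def using from_nat_into_surj[OF countable_compact_opens that] .
  define \<Phi> where "\<Phi> \<mu> = (\<lambda>n. measure \<mu> (E n))" for \<mu> :: "'a measure"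
  define S where "S = \<Phi> ` prob_measures X"
  define g where "g = inv_into (prob_measures X) \<Phi>"
  have inj: "inj_on \<Phi> (prob_measures X)"
    using E_surj by (intro inj_onI prob_measures_eqI) (auto simp: \<Phi>_def fun_eq_iff)
  have topT: "topspace ?T = prob_measures X"
    using topspace_weak_topology ind[OF empty_compact_opens] .
  have g: "g z \<in> prob_measures X" "\<Phi> (g z) = z" if "z \<in> S" for z
    using that unfolding S_def g_def by (auto intro: inv_into_into f_inv_into_f)
  have meas: "continuous_map (top_of_set S) euclideanreal (\<lambda>z. measure (g z) K)"
    if K: "K \<in> compact_opens X" for K
  proof -
    obtain n where n: "E n = K"
      using E_surj[OF K] by auto
    have "continuous_on S (\<lambda>z. z n)"
      by (intro continuous_on_subset[OF continuous_on_product_coordinates]) auto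
    moreover have "measure (g z) K = z n" if "z \<in> S" for z
      using g(2)[OF that] n by (auto simp: \<Phi>_def fun_eq_iff)
    ultimately show ?thesis
      by (simp cong: continuous_on_cong)
  qed
  \<comment> \<open>On \<open>S\<close> the integral is a uniform limit of finite combinations of
    coordinates: two approximation errors and one continuity error, each at most
    \<open>e / 4\<close>, sum to less than \<open>e\<close>.\<close>
  have int: "continuous_map (top_of_set S) euclideanreal (\<lambda>z. \<integral>x. f x \<partial>g z)" if f: "f \<in> F" for f
  proof -
    have "continuous_on S (\<lambda>z. \<integral>x. f x \<partial>g z)"
      unfolding continuous_on_iff
    proof (intro ballI allI impI)
      fix z and e :: real
      assume z: "z \<in> S" and "e > 0"
      then have "f \<in> C_0 X" "e / 4 > 0"
        using f F by auto
      then obtain I :: "int set" and K c where I: "finite I" "\<And>i. i \<in> I \<Longrightarrow> K i \<in> compact_opens X"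
        "\<And>\<mu>. \<mu> \<in> prob_measures X \<Longrightarrow> \<bar>(\<integral>x. f x \<partial>\<mu>) - (\<Sum>i\<in>I. c i * measure \<mu> (K i))\<bar> \<le> e / 4"
        using C_0_integral_uniform_approx by blast
      let ?h = "\<lambda>z. \<Sum>i\<in>I. c i * measure (g z) (K i)"
      have "continuous_on S ?h"
        using meas[OF I(2)] by (intro continuous_intros) auto
      then obtain d where d: "d > 0" "\<And>y. y \<in> S \<Longrightarrow> dist y z < d \<Longrightarrow> dist (?h y) (?h z) < e / 4"
        using z \<open>e / 4 > 0\<close> unfolding continuous_on_iff by blast
      have "dist (\<integral>x. f x \<partial>g y) (\<integral>x. f x \<partial>g z) < e" if y: "y \<in> S" "dist y z < d" for y
        using d(2)[OF y] I(3)[OF g(1)[OF y(1)]] I(3)[OF g(1)[OF z]] \<open>e > 0\<close>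
        unfolding dist_real_def by linarith
      then show "\<exists>d>0. \<forall>y\<in>S. dist y z < d \<longrightarrow> dist (\<integral>x. f x \<partial>g y) (\<integral>x. f x \<partial>g z) < e"
        using d(1) by blast
    qed
    then show ?thesis
      by simp
  qed
  have "homeomorphic_maps ?T (top_of_set S) \<Phi> g"
    unfolding homeomorphic_maps_def
  proof (intro conjI ballI)
    \<comment> \<open>Each coordinate is the integral of an indicator, which is a test function in
      \<open>F\<close>.\<close>
    have comp: "continuous_map ?T euclideanreal (\<lambda>\<mu>. measure \<mu> (E n))" for n
    proof (rule continuous_map_eq[OF continuous_map_weak_topology_integral[OF ind[OF E]]])
      fix \<mu> assume "\<mu> \<in> topspace ?T"
      then have \<mu>: "\<mu> \<in> prob_measures X"
        by (simp add: topT)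
      then have "E n \<inter> space \<mu> = E n"
        using compact_opens_subset[OF E] prob_measures_sets(2) by auto
      then show "(\<integral>x. indicator (E n) x \<partial>\<mu>) = measure \<mu> (E n)"
        by simp
    qed
    have "continuous_map ?T euclidean \<Phi>"
      by (subst euclidean_product_topology[symmetric])
         (simp add: continuous_map_componentwise_UNIV \<Phi>_def comp)
    then show "continuous_map ?T (top_of_set S) \<Phi>"
      by (auto simp: continuous_map_in_subtopology topT S_def)
    show "continuous_map (top_of_set S) ?T g"
      unfolding weak_topology_def
    proof (rule continuous_on_generated_topo)
      fix U assume "U \<in> {W X \<nu> f \<epsilon> | \<nu> f \<epsilon>. \<nu> \<in> prob_measures X \<and> f \<in> F \<and> \<epsilon> > 0}"
      then obtain \<nu> f \<epsilon> where U: "U = W X \<nu> f \<epsilon>" and f: "f \<in> F"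
        by blast
      \<comment> \<open>Subbasic sets pull back to preimages of intervals under the integral maps,
        so \<open>int\<close> suffices.\<close>
      have "g -` U \<inter> topspace (top_of_set S)
          = {z \<in> topspace (top_of_set S). (\<integral>x. f x \<partial>g z) \<in> ball (\<integral>x. f x \<partial>\<nu>) \<epsilon>}"
        using g(1) by (auto simp: U W_def dist_real_def abs_minus_commute)
      then show "openin (top_of_set S) (g -` U \<inter> topspace (top_of_set S))"
        using openin_continuous_map_preimage[OF int[OF f], of "ball (\<integral>x. f x \<partial>\<nu>) \<epsilon>"] by simp
    next
      show "g ` topspace (top_of_set S) \<subseteq> \<Union>{W X \<nu> f \<epsilon> | \<nu> f \<epsilon>. \<nu> \<in> prob_measures X \<and> f \<in> F \<and> \<epsilon> > 0}"
        using g(1) topT unfolding weak_topology_def topology_generated_by_topspace by auto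
    qed
    show "g (\<Phi> \<mu>) = \<mu>" if "\<mu> \<in> topspace ?T" for \<mu>
      using that inj by (simp add: g_def topT)
    show "\<Phi> (g z) = z" if "z \<in> topspace (top_of_set S)" for z
      using that g(2) by simp
  qed
  then show ?thesis
    using homeomorphic_maps_imp_homeomorphic_space by blast
qed

text \<open>Separability need not pass to subspaces, but second countability does; so it is
  established for \<open>S\<close> and separability is derived from it.\<close>

lemma weak_topology_separable_metrizable:
  assumes "F \<subseteq> C_0 X" "\<And>K. K \<in> compact_opens X \<Longrightarrow> indicator K \<in> F"
  shows "separable_space (weak_topology X F) \<and> metrizable_space (weak_topology X F)"
proof -
  obtain S :: "(nat \<Rightarrow> real) set" where S: "weak_topology X F homeomorphic_space top_of_set S"
    using weak_topology_homeomorphic_subset[OF assms] by blast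
  obtain \<B> :: "(nat \<Rightarrow> real) set set" where \<B>: "countable \<B>" "\<And>C. C \<in> \<B> \<Longrightarrow> openin (top_of_set S) C"
      "\<And>T. openin (top_of_set S) T \<Longrightarrow> \<exists>\<U>. \<U> \<subseteq> \<B> \<and> T = \<Union>\<U>"
    using subset_second_countable by metis
  have "\<exists>V\<in>\<B>. z \<in> V \<and> V \<subseteq> U" if "openin (top_of_set S) U" "z \<in> U" for U z
    using \<B>(3)[OF that(1)] that(2) by blast
  then have "second_countable (top_of_set S)"
    unfolding second_countable_def using \<B>(1,2) by blast
  then have "separable_space (top_of_set S)"
    by (rule second_countable_imp_separable_space)
  moreover have "metrizable_space (top_of_set S)"
    by (intro metrizable_space_subtopology metrizable_space_euclidean)
  ultimately show ?thesis
    by (simp add: homeomorphic_separable_space[OF S] homeomorphic_metrizable_space[OF S])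
qed

text \<open>A compact set in a Hausdorff space is closed, so \<open>K\<close> is clopen: its
  indicator is continuous and its support is \<open>K\<close> itself.\<close>

lemma indicator_compact_opens_C_sc:
  assumes K: "K \<in> compact_opens X"
  shows "indicator K \<in> C_sc X"
proof -
  have "openin X K" "compactin X K" "closedin X K"
    using K Hausdorff by (auto simp: compact_opens_def compactin_imp_closedin)
  have "continuous_map X euclideanreal (indicator K)"
    unfolding continuous_map_def
  proof (intro conjI allI impI)
    fix U :: "real set"
    have "{x \<in> topspace X. indicator K x \<in> U}
        = (if 1 \<in> U then K else {}) \<union> (if 0 \<in> U then topspace X - K else {})"
      using compact_opens_subset[OF K] by (auto simp: indicator_def)
    then show "openin X {x \<in> topspace X. indicator K x \<in> U}"
      using \<open>openin X K\<close> \<open>closedin X K\<close> by auto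
  qed auto
  moreover have "{x \<in> topspace X. indicator K x \<noteq> (0::real)} = K"
    using compact_opens_subset[OF K] by (auto simp: indicator_def)
  then have "support_in X (indicator K) = K"
    using \<open>closedin X K\<close> by (simp add: support_in_def closure_of_closedin)
  ultimately show ?thesis
    using \<open>compactin X K\<close> by (simp add: C_sc_def)
qed

end

text \<open>The set where \<open>\<bar>f x\<bar>\<close> is at least \<open>\<epsilon>\<close> is
  closed and lies in the compact support.\<close>

lemma C_sc_subset_C_0: "C_sc X \<subseteq> C_0 X"
proof
  fix f assume f: "f \<in> C_sc X"
  have "compactin X {x \<in> topspace X. f x \<in> {..-\<epsilon>} \<union> {\<epsilon>..}}" if "\<epsilon> > 0" for \<epsilon>
  proof (rule closed_compactin)
    show "compactin X (support_in X f)"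
      using f by (simp add: C_sc_def)
    have "{x \<in> topspace X. f x \<noteq> 0} \<subseteq> support_in X f"
      unfolding support_in_def by (intro closure_of_subset) auto
    then show "{x \<in> topspace X. f x \<in> {..-\<epsilon>} \<union> {\<epsilon>..}} \<subseteq> support_in X f"
      using that by auto
    show "closedin X {x \<in> topspace X. f x \<in> {..-\<epsilon>} \<union> {\<epsilon>..}}"
      using f by (intro closedin_continuous_map_preimage[of X euclideanreal]) (auto simp: C_sc_def)
  qed
  then show "f \<in> C_0 X"
    using f by (simp add: C_0_def C_sc_def vanishes_at_infinity_def)
qed

theorem theorem2p4:
  fixes X :: "'a topology"
  assumes "locally_compact_space X"
    and "Hausdorff_space X"
    and "countable {A. elementary_event (sets (borel_of X)) A}"
  shows "(separable_space (vague_topology_I X) \<and> metrizable_space (vague_topology_I X)) \<and>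
         (separable_space (vague_topology_II X) \<and> metrizable_space (vague_topology_II X))"
proof -
  interpret countable_lc_Hausdorff X
    using assms countable_topspace_if_countable_elementary_events by unfold_locales
  have "vague_topology_I X = weak_topology X (C_sc X)" "vague_topology_II X = weak_topology X (C_0 X)"
    by (simp_all add: vague_topology_I_def vague_topology_II_def weak_topology_def)
  \<comment> \<open>The inclusion \<open>C_sc_subset_C_0\<close> serves twice: it admits
    \<open>C_sc X\<close> as a test class and puts the indicators into \<open>C_0 X\<close>.\<close>
  then show ?thesis
    using weak_topology_separable_metrizable[of "C_sc X"] weak_topology_separable_metrizable[of "C_0 X"]
      C_sc_subset_C_0 indicator_compact_opens_C_sc by auto
qed

end
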